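(* If a hypersequent $G$ has a derivation in $\mathbf{HR}$, then it has a CAN-free derivation in $\mathbf{HR}$.
   Context: Terms. Fix a countable set of variables $x,y,z,\dots$. Terms (in negation normal form) are generated by $A ::= x \mid \overline{x} \mid 0 \mid A+A \mid rA \mid A\sqcup A \mid A\sqcap A$, where $x$ is a variable, $\overline{x}$ is the corresponding negated variable, and $r\in\mathbb{R}_{>0}$. The negation $\overline{A}$ of a term is defined by $\overline{x}$ (for $x$), $\overline{\overline{x}}=x$, $\overline{0}=0$, $\overline{A+B}=\overline{A}+\overline{B}$, $\overline{rA}=r\overline{A}$, $\overline{A\sqcup B}=\overline{A}\sqcap\overline{B}$, $\overline{A\sqcap B}=\overline{A}\sqcup\overline{B}$. A weighted term is $r.A$ with $r\in\mathbb{R}_{>0}$; a sequent $\vdash\Gamma$ has $\Gamma$ a finite (possibly empty) multiset of weighted terms; a hypersequent is a nonempty finite multiset of sequents, written $\vdash\Gamma_1\mid\cdots\mid\vdash\Gamma_n$, and $G\mid\vdash\Gamma$ denotes the hypersequent $G$ with the sequent $\vdash\Gamma$ added. For a finite (possibly empty) sequence $\vec r=(r_1,\dots,r_n)$ of strictly positive reals, $\vec r.A$ is the multiset $r_1.A,\dots,r_n.A$, $\sum\vec r=r_1+\dots+r_n$, and $s\vec r=(sr_1,\dots,sr_n)$; for $s>0$, $s.\Gamma$ multiplies every weight in $\Gamma$ by $s$. The calculus $\mathbf{HR}$ has the rules (vectors are finite sequences of strictly positive reals): INIT: the hypersequent $\vdash$ (one empty sequent) with no premises. W: from $G$ infer $G\mid\vdash\Gamma$.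 C: from $G\mid\vdash\Gamma\mid\vdash\Gamma$ infer $G\mid\vdash\Gamma$. S: from $G\mid\vdash\Gamma_1,\Gamma_2$ infer $G\mid\vdash\Gamma_1\mid\vdash\Gamma_2$. M: from $G\mid\vdash\Gamma_1$ and $G\mid\vdash\Gamma_2$ infer $G\mid\vdash\Gamma_1,\Gamma_2$. T: for $r>0$, from $G\mid\vdash r.\Gamma$ infer $G\mid\vdash\Gamma$. ID: if $\sum\vec r=\sum\vec s$, from $G\mid\vdash\Gamma$ infer $G\mid\vdash\Gamma,\vec r.x,\vec s.\overline{x}$ ($x$ a variable). 0: from $G\mid\vdash\Gamma$ infer $G\mid\vdash\Gamma,\vec r.0$. $+$: from $G\mid\vdash\Gamma,\vec r.A,\vec r.B$ infer $G\mid\vdash\Gamma,\vec r.(A+B)$. $\times$: from $G\mid\vdash\Gamma,(s\vec r).A$ infer $G\mid\vdash\Gamma,\vec r.(sA)$. $\sqcup$: from $G\mid\vdash\Gamma,\vec r.A\mid\vdash\Gamma,\vec r.B$ infer $G\mid\vdash\Gamma,\vec r.(A\sqcup B)$. $\sqcap$: from $G\mid\vdash\Gamma,\vec r.A$ and $G\mid\vdash\Gamma,\vec r.B$ infer $G\mid\vdash\Gamma,\vec r.(A\sqcap B)$. CAN: if $\sum\vec r=\sum\vec s$, from $G\mid\vdash\Gamma,\vec s.A,\vec r.\overline{A}$ infer $G\mid\vdash\Gamma$. A derivation is a finite tree of rule instances whose leaves are INIT; it is CAN-free if it contains no instance of CAN. *)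

theory Defs
  imports Complex_Main "HOL-Library.Multiset" "HOL-Library.Countable"
begin

typedef posreal = "{r :: real. 0 < r}"
  morphisms real_of_pos pos_of_real
  by (rule exI[of _ 1]) simp

setup_lifting type_definition_posreal

instantiation posreal :: comm_monoid_mult
begin

lift_definition one_posreal :: posreal is 1 by simp

lift_definition times_posreal :: "posreal \<Rightarrow> posreal \<Rightarrow> posreal" is "(*)" by simp

instance by standard (transfer; simp)+

end

text \<open>Terms in negation normal form: only variables carry a negation (\<open>CoVar\<close>), and
  negation of arbitrary terms is the derived operation \<open>neg\<close>.\<close>

datatype 'v trm =
    Var 'v
  | CoVar 'v
  | Zero
  | Plus "'v trm" "'v trm"
  | Scale posreal "'v trm"
  | Join "'v trm" "'v trm"
  | Meet "'v trm" "'v trm"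

primrec neg :: "'v trm \<Rightarrow> 'v trm" where
  "neg (Var x) = CoVar x"
| "neg (CoVar x) = Var x"
| "neg Zero = Zero"
| "neg (Plus A B) = Plus (neg A) (neg B)"
| "neg (Scale r A) = Scale r (neg A)"
| "neg (Join A B) = Meet (neg A) (neg B)"
| "neg (Meet A B) = Join (neg A) (neg B)"

text \<open>The weighted term \<open>r.A\<close> is the pair \<open>(r, A)\<close>.  Hypersequents are nonempty by convention;
  the type also contains \<open>{#}\<close>, which serves as the empty context \<open>G\<close> in
  \<open>G | \<turnstile> \<Gamma>\<close> and is never the conclusion of a rule (lemma \<open>concl_nonempty\<close>).\<close>

type_synonym 'v sequent = "(posreal \<times> 'v trm) multiset"
type_synonym 'v hypersequent = "'v sequent multiset"

definition wvec :: "posreal list \<Rightarrow> 'v trm \<Rightarrow> 'v sequent" where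
  "wvec rs A = mset (map (\<lambda>r. (r, A)) rs)"

definition wsum :: "posreal list \<Rightarrow> real" where
  "wsum rs = sum_list (map real_of_pos rs)"

definition scale_seq :: "posreal \<Rightarrow> 'v sequent \<Rightarrow> 'v sequent" where
  "scale_seq s \<Gamma> = image_mset (\<lambda>(r, A). (s * r, A)) \<Gamma>"

datatype rule_name =
  INIT | W | C | S | M | T | ID | ZERO | PLUS | TIMES | JOIN | MEET | CAN

text \<open>\<open>hr_rule \<rho> Ps H\<close>: there is an instance of rule \<open>\<rho>\<close> with premises \<open>Ps\<close> and conclusion \<open>H\<close>.
  \<open>add_mset \<Gamma> G\<close> is \<open>G | \<turnstile> \<Gamma>\<close>.\<close>

inductive hr_rule :: "rule_name \<Rightarrow> 'v hypersequent list \<Rightarrow> 'v hypersequent \<Rightarrow> bool" where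
  init:
    "hr_rule INIT [] {# {#} #}"
| weakening:
    "G \<noteq> {#} \<Longrightarrow> hr_rule W [G] (add_mset \<Gamma> G)"
| contraction:
    "hr_rule C [add_mset \<Gamma> (add_mset \<Gamma> G)] (add_mset \<Gamma> G)"
| split:
    "hr_rule S [add_mset (\<Gamma>\<^sub>1 + \<Gamma>\<^sub>2) G] (add_mset \<Gamma>\<^sub>1 (add_mset \<Gamma>\<^sub>2 G))"
| mix:
    "hr_rule M [add_mset \<Gamma>\<^sub>1 G, add_mset \<Gamma>\<^sub>2 G] (add_mset (\<Gamma>\<^sub>1 + \<Gamma>\<^sub>2) G)"
| scaling:
    "hr_rule T [add_mset (scale_seq r \<Gamma>) G] (add_mset \<Gamma> G)"
| identity:
    "wsum rs = wsum ss \<Longrightarrow>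
     hr_rule ID [add_mset \<Gamma> G] (add_mset (\<Gamma> + wvec rs (Var x) + wvec ss (CoVar x)) G)"
| zero:
    "hr_rule ZERO [add_mset \<Gamma> G] (add_mset (\<Gamma> + wvec rs Zero) G)"
| plus:
    "hr_rule PLUS [add_mset (\<Gamma> + wvec rs A + wvec rs B) G] (add_mset (\<Gamma> + wvec rs (Plus A B)) G)"
| times:
    "hr_rule TIMES [add_mset (\<Gamma> + wvec (map ((*) s) rs) A) G]
       (add_mset (\<Gamma> + wvec rs (Scale s A)) G)"
| join:
    "hr_rule JOIN [add_mset (\<Gamma> + wvec rs A) (add_mset (\<Gamma> + wvec rs B) G)]
       (add_mset (\<Gamma> + wvec rs (Join A B)) G)"
| meet:
    "hr_rule MEET [add_mset (\<Gamma> + wvec rs A) G, add_mset (\<Gamma> + wvec rs B) G]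
       (add_mset (\<Gamma> + wvec rs (Meet A B)) G)"
| can:
    "wsum rs = wsum ss \<Longrightarrow>
     hr_rule CAN [add_mset (\<Gamma> + wvec ss A + wvec rs (neg A)) G] (add_mset \<Gamma> G)"

datatype 'v tree = Node rule_name (concl: "'v hypersequent") "'v tree list"

text \<open>INIT is the only rule without premises, so the leaves of a derivation are INIT instances.\<close>

fun derivation :: "'v tree \<Rightarrow> bool" where
  "derivation (Node \<rho> H ds) \<longleftrightarrow> hr_rule \<rho> (map concl ds) H \<and> (\<forall>d \<in> set ds. derivation d)"

fun can_free :: "'v tree \<Rightarrow> bool" where
  "can_free (Node \<rho> H ds) \<longleftrightarrow> \<rho> \<noteq> CAN \<and> (\<forall>d \<in> set ds. can_free d)"

lemma concl_nonempty: "hr_rule \<rho> Ps H \<Longrightarrow> H \<noteq> {#}"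
  by (induction rule: hr_rule.induct) auto

end

theory Submission
  imports Defs
begin

text \<open>The argument is semantic. Every rule, CAN included, preserves the property that under each
  real valuation of the variables some sequent of the hypersequent has nonnegative value. Conversely
  a hypersequent with this property has a CAN-free derivation: the logical rules are semantically
  invertible, so one may assume all terms atomic; then Gordan's alternative (proved by
  Fourier-Motzkin elimination) yields a nontrivial nonnegative combination of the sequents that
  vanishes as a linear form, and this combination is realised by T, S and C and closed by ID.\<close>

section \<open>Real-valued semantics\<close>

primrec term_val :: "('v \<Rightarrow> real) \<Rightarrow> 'v trm \<Rightarrow> real" where
  "term_val v (Var x) = v x"
| "term_val v (CoVar x) = - v x"
| "term_val v Zero = 0"
| "term_val v (Plus A B) = term_val v A + term_val v B"
| "term_val v (Scale r A) = real_of_pos r * term_val v A"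
| "term_val v (Join A B) = max (term_val v A) (term_val v B)"
| "term_val v (Meet A B) = min (term_val v A) (term_val v B)"

definition seq_val :: "('v \<Rightarrow> real) \<Rightarrow> 'v sequent \<Rightarrow> real" where
  "seq_val v \<Gamma> = (\<Sum>(r, A)\<in>#\<Gamma>. real_of_pos r * term_val v A)"

text \<open>The choice of \<open>\<Gamma>\<close> may depend on \<open>v\<close>, so
  \<open>|\<close> acts as a join in the reals; \<open>{#}\<close> is not valid.\<close>

definition valid :: "'v hypersequent \<Rightarrow> bool" where
  "valid H \<longleftrightarrow> (\<forall>v. \<exists>\<Gamma>\<in>#H. 0 \<le> seq_val v \<Gamma>)"

lemma real_of_pos_gt_0 [simp]: "0 < real_of_pos r"
  using real_of_pos by auto

lemma real_of_pos_ge_0 [simp]: "0 \<le> real_of_pos r"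
  using real_of_pos_gt_0 less_imp_le by blast

lemma real_of_pos_not_le_0 [simp]: "\<not> real_of_pos r \<le> 0"
  by (simp add: not_le)

lemma real_of_pos_times [simp]: "real_of_pos (r * s) = real_of_pos r * real_of_pos s"
  by (rule times_posreal.rep_eq)

lemma wsum_simps [simp]: "wsum [] = 0" "wsum (r # rs) = real_of_pos r + wsum rs"
  by (simp_all add: wsum_def)

lemma wsum_nonneg [simp]: "0 \<le> wsum rs"
  by (induction rs) auto

lemma wvec_simps [simp]: "wvec [] A = {#}" "wvec (r # rs) A = add_mset (r, A) (wvec rs A)"
  by (simp_all add: wvec_def)

lemma term_val_neg [simp]: "term_val v (neg A) = - term_val v A"
  by (induction A) (auto simp: max_def min_def)

lemma seq_val_simps [simp]:
  "seq_val v {#} = 0"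
  "seq_val v (add_mset (r, A) \<Gamma>) = real_of_pos r * term_val v A + seq_val v \<Gamma>"
  "seq_val v (\<Gamma> + \<Delta>) = seq_val v \<Gamma> + seq_val v \<Delta>"
  by (simp_all add: seq_val_def)

lemma seq_val_wvec [simp]: "seq_val v (wvec rs A) = wsum rs * term_val v A"
  by (induction rs) (auto simp: algebra_simps)

lemma wsum_scale [simp]: "wsum (map ((*) s) rs) = real_of_pos s * wsum rs"
  by (induction rs) (auto simp: algebra_simps)

lemma seq_val_scale [simp]: "seq_val v (scale_seq s \<Gamma>) = real_of_pos s * seq_val v \<Gamma>"
  by (induction \<Gamma>) (auto simp: scale_seq_def algebra_simps)

lemma valid_add_mset:
  "valid (add_mset \<Gamma> H) \<longleftrightarrow> (\<forall>v. 0 \<le> seq_val v \<Gamma> \<or> (\<exists>\<Delta>\<in>#H. 0 \<le> seq_val v \<Delta>))"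
  by (auto simp: valid_def)

text \<open>Multiplication by a nonnegative \<open>w\<close> commutes with \<open>max\<close>. Being
  an equivalence, this gives both soundness and semantic invertibility of the \<squnion> rule; the
  next lemma does the same for \<sqinter>.\<close>

lemma max_weighted_nonneg:
  fixes a b c w :: real
  assumes "0 \<le> w"
  shows "0 \<le> c + w * max a b \<longleftrightarrow> 0 \<le> c + w * a \<or> 0 \<le> c + w * b"
proof -
  have "w * max a b = max (w * a) (w * b)"
    using assms by (metis max_mult_distrib_left max.commute linorder_not_le)
  then show ?thesis by (auto simp: max_def)
qed

lemma min_weighted_nonneg:
  fixes a b c w :: real
  assumes "0 \<le> w"
  shows "0 \<le> c + w * min a b \<longleftrightarrow> 0 \<le> c + w * a \<and> 0 \<le> c + w * b"
proof -
  have "w * min a b = min (w * a) (w * b)"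
    using assms by (metis min_mult_distrib_left min.commute linorder_not_le)
  then show ?thesis by (auto simp: min_def)
qed

section \<open>Soundness of the rules\<close>

lemma hr_rule_sound:
  assumes "hr_rule \<rho> Ps H" "\<forall>P\<in>set Ps. valid P"
  shows "valid H"
  using assms
proof (induction rule: hr_rule.induct)
  case (contraction \<Gamma> G)
  then show ?case by (auto simp: valid_def)
next
  case (split \<Gamma>\<^sub>1 \<Gamma>\<^sub>2 G)
  then show ?case
    by (simp add: valid_add_mset) (smt (verit))
next
  case (mix \<Gamma>\<^sub>1 G \<Gamma>\<^sub>2)
  then show ?case
    by (simp add: valid_add_mset) (smt (verit))
next
  case (scaling r \<Gamma> G)
  then show ?case
    by (auto simp: valid_add_mset zero_le_mult_iff)
next
  case (identity rs ss \<Gamma> G x)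
  then show ?case by (simp add: valid_add_mset)
next
  case (plus \<Gamma> rs A B G)
  then show ?case by (simp add: valid_add_mset algebra_simps)
next
  case (times \<Gamma> s rs A G)
  then show ?case by (simp add: valid_add_mset algebra_simps)
next
  case (join \<Gamma> rs A B G)
  then show ?case by (simp add: valid_add_mset max_weighted_nonneg)
next
  case (meet \<Gamma> rs A G B)
  then show ?case by (simp add: valid_add_mset min_weighted_nonneg) blast
next
  \<comment> \<open>Equal weight sums make the contributions of \<open>A\<close> and
    \<open>neg A\<close> cancel.\<close>
  case (can rs ss \<Gamma> A G)
  then show ?case by (simp add: valid_add_mset)
qed (auto simp: valid_def)

lemma derivation_sound: "derivation d \<Longrightarrow> valid (concl d)"
proof (induction d)
  case (Node \<rho> H ds)
  then have "hr_rule \<rho> (map concl ds) H" "\<forall>P\<in>set (map concl ds). valid P" by auto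
  then show ?case using hr_rule_sound by (metis tree.sel)
qed

section \<open>Gordan's alternative\<close>

text \<open>All coefficients are strictly positive and at least one generator occurs, so the zero
  function belongs to the cone only through a nontrivial combination.\<close>

inductive_set cone :: "('v \<Rightarrow> real) set \<Rightarrow> ('v \<Rightarrow> real) set" for F where
  base: "f \<in> F \<Longrightarrow> f \<in> cone F"
| add: "f \<in> cone F \<Longrightarrow> g \<in> cone F \<Longrightarrow> (\<lambda>x. f x + g x) \<in> cone F"
| scale: "f \<in> cone F \<Longrightarrow> 0 < c \<Longrightarrow> (\<lambda>x. c * f x) \<in> cone F"

lemma cone_subset:
  assumes "g \<in> cone F'" "F' \<subseteq> cone F"
  shows "g \<in> cone F"
  using assms
proof (induction rule: cone.induct)
  case (add f g)
  then show ?case by (intro cone.add)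
next
  case (scale f c)
  then show ?case by (intro cone.scale)
qed blast

text \<open>This supplies the value of the eliminated variable in Fourier-Motzkin elimination, where
  bounds from one or both sides may be absent.\<close>

lemma real_between_finite_sets:
  fixes L U :: "real set"
  assumes "finite L" "finite U" "\<And>l u. l \<in> L \<Longrightarrow> u \<in> U \<Longrightarrow> l < u"
  obtains z where "\<forall>l\<in>L. l < z" "\<forall>u\<in>U. z < u"
proof -
  obtain m where m: "\<forall>u\<in>U. m \<le> u"
    using bdd_below_finite[OF assms(2)] by (auto simp: bdd_below_def)
  obtain k where k: "\<forall>l\<in>L. l \<le> k"
    using bdd_above_finite[OF assms(1)] by (auto simp: bdd_above_def)
  consider "L = {}" | "U = {}" | "L \<noteq> {}" "U \<noteq> {}" by blast
  then show thesis
  proof cases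
    case 1
    show thesis by (rule that[of "m - 1"]) (use 1 m in force)+
  next
    case 2
    show thesis by (rule that[of "k + 1"]) (use 2 k in force)+
  next
    case 3
    then have "Max L < Min U" using assms by simp
    then obtain z where "Max L < z" "z < Min U" using dense by blast
    then show thesis using that[of z] 3 assms by simp
  qed
qed

text \<open>Induction on \<open>X\<close> eliminates one coordinate \<open>y\<close>: forms of
  opposite sign at \<open>y\<close> are paired so that it cancels, and the hypothesis passes to the
  resulting set \<open>F'\<close>.\<close>

lemma gordan_alternative:
  fixes F :: "('v \<Rightarrow> real) set"
  assumes "finite X" "finite F" "\<And>v. \<exists>f\<in>F. 0 \<le> (\<Sum>x\<in>X. f x * v x)"
  shows "\<exists>g\<in>cone F. \<forall>x\<in>X. g x = 0"
  using assms
proof (induction X arbitrary: F rule: finite_induct)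
  case empty
  then obtain f where "f \<in> F" by blast
  then show ?case by (auto intro: cone.base)
next
  case (insert y X)
  \<comment> \<open>For \<open>p \<in> P\<close> and \<open>n \<in> N\<close> the multipliers
    \<open>p y\<close> and \<open>- n y\<close> are positive, so the result stays in the cone, and
    its value at \<open>y\<close> is \<open>p y * n y - n y * p y = 0\<close>.\<close>
  define comb :: "('v \<Rightarrow> real) \<Rightarrow> ('v \<Rightarrow> real) \<Rightarrow> 'v \<Rightarrow> real"
    where "comb p n = (\<lambda>x. p y * n x + (- n y) * p x)" for p n
  define P where "P = {f\<in>F. 0 < f y}"
  define N where "N = {f\<in>F. f y < 0}"
  define Z where "Z = {f\<in>F. f y = 0}"
  define F' where "F' = Z \<union> (\<lambda>(p, n). comb p n) ` (P \<times> N)"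
  have fin: "finite P" "finite N" "finite F'"
    using insert.prems(1) by (simp_all add: P_def N_def Z_def F'_def)
  have zero_y: "f y = 0" if "f \<in> F'" for f
    using that by (auto simp: F'_def Z_def comb_def)
  have "comb p n \<in> cone F" if "p \<in> P" "n \<in> N" for p n
    unfolding comb_def using that
    by (intro cone.add cone.scale cone.base) (auto simp: P_def N_def)
  then have "F' \<subseteq> cone F"
    by (auto simp: F'_def Z_def cone.base)
  moreover have "\<exists>f\<in>F'. 0 \<le> (\<Sum>x\<in>X. f x * v x)" for v
  \<comment> \<open>If all of \<open>F'\<close> were negative at \<open>v\<close>, a suitable value
    \<open>z\<close> at \<open>y\<close> would make all of \<open>F\<close> negative.\<close>
  proof (rule ccontr)
    assume "\<not> ?thesis"
    then have neg: "(\<Sum>x\<in>X. f x * v x) < 0" if "f \<in> F'" for f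
      using that by force
    define s where "s f = (\<Sum>x\<in>X. f x * v x)" for f
    have s_comb: "s (comb p n) = p y * s n - n y * s p" for p n
      by (simp add: s_def comb_def sum_distrib_left sum_subtractf algebra_simps)
    \<comment> \<open>The condition \<open>f y * z + s f < 0\<close> bounds \<open>z\<close> from
      below by \<open>s n / - n y\<close> and from above by \<open>- s p / p y\<close>; negativity
      of \<open>comb p n\<close> makes these bounds compatible.\<close>
    have bounds: "s n / - n y < - s p / p y" if "p \<in> P" "n \<in> N" for p n
    proof -
      have "comb p n \<in> F'" using that by (auto simp: F'_def)
      then have "p y * s n - n y * s p < 0"
        using neg s_comb s_def by metis
      moreover have "0 < p y" "n y < 0" using that by (auto simp: P_def N_def)
      ultimately show ?thesis
        by (simp add: divide_simps mult.commute)
    qed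
    obtain z where z: "\<forall>n\<in>N. s n / - n y < z" "\<forall>p\<in>P. z < - s p / p y"
    proof (rule real_between_finite_sets[of "(\<lambda>n. s n / - n y) ` N" "(\<lambda>p. - s p / p y) ` P"])
    qed (use fin bounds in auto)
    define w where "w = v(y := z)"
    have val: "(\<Sum>x\<in>insert y X. f x * w x) = f y * z + s f" for f
    proof -
      have "(\<Sum>x\<in>X. f x * w x) = s f"
        unfolding s_def w_def using insert.hyps by (intro sum.cong) auto
      then show ?thesis using insert.hyps by (simp add: w_def)
    qed
    have "f y * z + s f < 0" if "f \<in> F" for f
    proof (rule linorder_cases[of "f y" 0])
      assume "f y < 0"
      moreover from this have "s f / - f y < z" using z(1) that by (auto simp: N_def)
      ultimately show ?thesis by (simp add: field_simps)
    next
      assume "f y = 0"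
      then have "f \<in> F'" using that by (auto simp: F'_def Z_def)
      then show ?thesis using neg s_def \<open>f y = 0\<close> by simp
    next
      assume "0 < f y"
      moreover from this have "z < - s f / f y" using z(2) that by (auto simp: P_def)
      ultimately show ?thesis by (simp add: field_simps)
    qed
    moreover obtain f where "f \<in> F" "0 \<le> (\<Sum>x\<in>insert y X. f x * w x)"
      using insert.prems(2) by blast
    ultimately show False using val by force
  qed
  then obtain g where g: "g \<in> cone F'" "\<forall>x\<in>X. g x = 0"
    using insert.IH[of F'] fin by blast
  \<comment> \<open>Every member of \<open>F'\<close> vanishes at \<open>y\<close>, and the cone
    operations preserve this.\<close>
  have "g y = 0"
    using g(1) by (induction rule: cone.induct) (auto simp: zero_y)
  ultimately show ?case using g cone_subset by (metis insert_iff)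
qed

section \<open>CAN-free derivability\<close>

definition cf_derivable :: "'v hypersequent \<Rightarrow> bool" where
  "cf_derivable H \<longleftrightarrow> (\<exists>d. derivation d \<and> can_free d \<and> concl d = H)"

lemma cf_derivable_rule:
  assumes "hr_rule \<rho> Ps H" "\<rho> \<noteq> CAN" "\<forall>P\<in>set Ps. cf_derivable P"
  shows "cf_derivable H"
proof -
  obtain d where d: "\<forall>P\<in>set Ps. derivation (d P) \<and> can_free (d P) \<and> concl (d P) = P"
    using assms(3) unfolding cf_derivable_def by metis
  then have "map concl (map d Ps) = Ps" by (simp add: map_idI)
  with assms d show ?thesis
    unfolding cf_derivable_def by (intro exI[of _ "Node \<rho> H (map d Ps)"]) auto
qed

text \<open>Rule W requires a nonempty context, so the sequents of \<open>G\<close> are added one by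
  one to a singleton.\<close>

lemma cf_weakening: "cf_derivable {#\<Delta>#} \<Longrightarrow> cf_derivable (add_mset \<Delta> G)"
proof (induction G)
  case (add \<Gamma> G)
  then show ?case
    using cf_derivable_rule[OF hr_rule.weakening[of "add_mset \<Delta> G" \<Gamma>]]
    by (simp add: add_mset_commute)
qed

lemma cf_contraction:
  assumes "\<Gamma> \<in># H" "cf_derivable (add_mset \<Gamma> H)"
  shows "cf_derivable H"
  using assms cf_derivable_rule[OF hr_rule.contraction[of \<Gamma> "H - {#\<Gamma>#}"]] by simp

text \<open>Every linear combination of sequents of \<open>H\<close> with positive coefficients is represented by a
  sequent that may be dropped from a hypersequent extending \<open>H\<close>.  The hypersequent \<open>K\<close> has to vary
  because the case of a sum adds one summand after the other.\<close>

lemma cone_redundant: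
  fixes H :: "'v hypersequent"
  assumes "g \<in> cone ((\<lambda>\<Gamma> x. seq_val (\<lambda>y. of_bool (y = x)) \<Gamma>) ` set_mset H)"
  shows "\<exists>\<Delta>. (\<lambda>x. seq_val (\<lambda>y. of_bool (y = x)) \<Delta>) = g \<and>
    snd ` set_mset \<Delta> \<subseteq> (\<Union>\<Gamma>\<in>set_mset H. snd ` set_mset \<Gamma>) \<and>
    (\<forall>K. H \<subseteq># K \<longrightarrow> cf_derivable (add_mset \<Delta> K) \<longrightarrow> cf_derivable K)"
    (is "\<exists>\<Delta>. ?R \<Delta> g")
  using assms
proof (induction rule: cone.induct)
  case (base f)
  \<comment> \<open>A generator comes from a sequent of \<open>H\<close>, hence of \<open>K\<close>,
    so contraction absorbs the extra copy.\<close>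
  then show ?case by (auto intro!: cf_contraction dest: mset_subset_eqD)
next
  case (add f g)
  then obtain \<Delta> \<Delta>' where \<Delta>: "?R \<Delta> f" "?R \<Delta>' g" by blast
  have "cf_derivable K" if K: "H \<subseteq># K" "cf_derivable (add_mset (\<Delta> + \<Delta>') K)" for K
  proof -
    \<comment> \<open>Rule S separates the summands; \<open>\<Delta>\<close> is dropped first, with
      \<open>\<Delta>'\<close> counted as context.\<close>
    have "cf_derivable (add_mset \<Delta> (add_mset \<Delta>' K))"
      using K cf_derivable_rule[OF hr_rule.split] by simp
    moreover have "H \<subseteq># add_mset \<Delta>' K"
      using K(1) by (rule subset_mset.order_trans) simp
    ultimately have "cf_derivable (add_mset \<Delta>' K)" using \<Delta>(1) by blast
    then show ?thesis using \<Delta>(2) K(1) by blast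
  qed
  then show ?case using \<Delta> by (intro exI[of _ "\<Delta> + \<Delta>'"]) (auto simp: fun_eq_iff)
next
  case (scale f c)
  then obtain \<Delta> where \<Delta>: "?R \<Delta> f" by blast
  define r where "r = pos_of_real c"
  have r: "real_of_pos r = c" using scale.hyps by (simp add: r_def pos_of_real_inverse)
  have "cf_derivable K" if K: "H \<subseteq># K" "cf_derivable (add_mset (scale_seq r \<Delta>) K)" for K
    using K \<Delta> cf_derivable_rule[OF hr_rule.scaling[of r \<Delta> K]] by simp
  moreover have "snd ` set_mset (scale_seq r \<Delta>) = snd ` set_mset \<Delta>"
    by (force simp: scale_seq_def)
  ultimately show ?case
    using \<Delta> r by (intro exI[of _ "scale_seq r \<Delta>"]) (auto simp: fun_eq_iff)
qed

section \<open>Atomic hypersequents\<close>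

definition atoms :: "'v set \<Rightarrow> 'v trm set" where
  "atoms X = Var ` X \<union> CoVar ` X"

text \<open>On atoms a sequent is a linear form in the valuation; the unit valuation at
  \<open>x\<close> reads off its coefficient, the weight of \<open>Var x\<close> minus that of
  \<open>CoVar x\<close>.\<close>

lemma seq_val_atomic:
  assumes "finite X" "snd ` set_mset \<Gamma> \<subseteq> atoms X"
  shows "seq_val v \<Gamma> = (\<Sum>x\<in>X. seq_val (\<lambda>y. of_bool (y = x)) \<Gamma> * v x)"
  using assms(2)
proof (induction \<Gamma>)
  case (add p \<Gamma>)
  obtain r A where p: "p = (r, A)" by fastforce
  with add.prems have "A \<in> atoms X" by auto
  then have "term_val v A = (\<Sum>x\<in>X. term_val (\<lambda>y. of_bool (y = x)) A * v x)"
    using assms(1) by (auto simp: atoms_def sum_negf of_bool_def if_distrib[of "\<lambda>a. a * _"]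
        cong: if_cong)
  with add p show ?case
    by (simp add: distrib_right sum.distrib sum_distrib_left mult.assoc)
qed simp

lemma exact_wvec:
  "\<exists>rs. {#q \<in># \<Gamma>. snd q = A#} = wvec rs A"
proof (induction \<Gamma>)
  case empty
  show ?case by (rule exI[of _ "[]"]) simp
next
  case (add q \<Gamma>)
  then obtain rs where rs: "{#q \<in># \<Gamma>. snd q = A#} = wvec rs A" by blast
  show ?case
  proof (cases "snd q = A")
    case True
    then have "{#q \<in># add_mset q \<Gamma>. snd q = A#} = wvec (fst q # rs) A" using rs by auto
    then show ?thesis by blast
  qed (use rs in auto)
qed

text \<open>A vanishing coefficient means that \<open>Var x\<close> and \<open>CoVar x\<close> have
  equal total weight, so ID introduces the variables one at a time, starting from INIT.\<close>

lemma cf_derivable_atomic_sequent: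
  assumes "finite X" "snd ` set_mset \<Delta> \<subseteq> atoms X"
    and "\<And>x. x \<in> X \<Longrightarrow> seq_val (\<lambda>y. of_bool (y = x)) \<Delta> = 0"
  shows "cf_derivable {#\<Delta>#}"
  using assms
proof (induction X arbitrary: \<Delta> rule: finite_induct)
  case empty
  then have "\<Delta> = {#}" by (simp add: atoms_def)
  then show ?case using cf_derivable_rule[OF hr_rule.init] by simp
next
  case (insert z X)
  define \<Delta>' where "\<Delta>' = {#q \<in># \<Delta>. snd q \<noteq> Var z \<and> snd q \<noteq> CoVar z#}"
  obtain rs where rs: "{#q \<in># \<Delta>. snd q = Var z#} = wvec rs (Var z)"
    using exact_wvec by blast
  obtain ss where ss: "{#q \<in># \<Delta>. snd q = CoVar z#} = wvec ss (CoVar z)"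
    using exact_wvec by blast
  have \<Delta>: "\<Delta> = \<Delta>' + wvec rs (Var z) + wvec ss (CoVar z)"
    unfolding \<Delta>'_def rs[symmetric] ss[symmetric] by (rule multiset_eqI) auto
  have atomic: "snd ` set_mset \<Delta>' \<subseteq> atoms X"
    using insert.prems(1) by (auto simp: \<Delta>'_def atoms_def)
  have "seq_val (\<lambda>y. of_bool (y = x)) \<Delta>' = 0" if "x \<in> X" for x
  proof -
    have "z \<noteq> x" using insert.hyps that by blast
    then show ?thesis using insert.prems(2)[of x] that unfolding \<Delta> by simp
  qed
  then have "cf_derivable {#\<Delta>'#}" using insert.IH atomic by blast
  \<comment> \<open>No atom of \<open>\<Delta>'\<close> mentions \<open>z\<close>, so the
    coefficient at \<open>z\<close> comes from \<open>rs\<close> and \<open>ss\<close>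
    alone.\<close>
  moreover have "seq_val (\<lambda>y. of_bool (y = z)) \<Delta>' = 0"
    using insert.hyps by (subst seq_val_atomic[OF _ atomic]) auto
  then have "wsum rs = wsum ss"
    using insert.prems(2)[of z] unfolding \<Delta> by simp
  ultimately show ?case
    using cf_derivable_rule[OF hr_rule.identity[of rs ss \<Delta>' "{#}" z]] \<Delta> by simp
qed

text \<open>The form given by Gordan's alternative vanishes on \<open>X\<close> and is represented
  by a derivable sequent; weakening adds \<open>H\<close> to it, and \<open>cone_redundant\<close>
  then removes it.\<close>

lemma cf_derivable_atomic:
  assumes atomic: "\<And>\<Gamma>. \<Gamma> \<in># H \<Longrightarrow> snd ` set_mset \<Gamma> \<subseteq> atoms UNIV" and "valid H"
  shows "cf_derivable H"
proof -
  define X where "X = (\<Union>\<Gamma>\<in>set_mset H. \<Union>A\<in>snd ` set_mset \<Gamma>. set_trm A)"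
  define F where "F = (\<lambda>\<Gamma> x. seq_val (\<lambda>y. of_bool (y = x)) \<Gamma>) ` set_mset H"
  have "finite (set_trm A)" for A :: "'a trm" by (induction A) auto
  then have "finite X" by (auto simp: X_def)
  have atomicX: "snd ` set_mset \<Gamma> \<subseteq> atoms X" if "\<Gamma> \<in># H" for \<Gamma>
  proof
    fix A assume A: "A \<in> snd ` set_mset \<Gamma>"
    then have "A \<in> atoms UNIV" "set_trm A \<subseteq> X" using atomic that by (auto simp: X_def)
    then show "A \<in> atoms X" by (auto simp: atoms_def)
  qed
  have "\<exists>f\<in>F. 0 \<le> (\<Sum>x\<in>X. f x * v x)" for v
    using \<open>valid H\<close> seq_val_atomic[OF \<open>finite X\<close> atomicX] unfolding valid_def F_def by force
  then obtain g where g: "g \<in> cone F" "\<forall>x\<in>X. g x = 0"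
    using gordan_alternative[OF \<open>finite X\<close>, of F] unfolding F_def by blast
  obtain \<Delta> where \<Delta>: "(\<lambda>x. seq_val (\<lambda>y. of_bool (y = x)) \<Delta>) = g"
      "snd ` set_mset \<Delta> \<subseteq> (\<Union>\<Gamma>\<in>set_mset H. snd ` set_mset \<Gamma>)"
      "cf_derivable (add_mset \<Delta> H) \<Longrightarrow> cf_derivable H"
    using cone_redundant[OF g(1)[unfolded F_def]] by blast
  have "cf_derivable {#\<Delta>#}"
  proof (rule cf_derivable_atomic_sequent[OF \<open>finite X\<close>])
    show "snd ` set_mset \<Delta> \<subseteq> atoms X" using \<Delta>(2) atomicX by blast
  qed (use \<Delta>(1) g(2) in auto)
  then show ?thesis using \<Delta>(3) cf_weakening by blast
qed

section \<open>Reduction to atomic terms\<close>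

text \<open>\<open>Zero\<close> counts 1 because it is not an atom and removing it must lower the
  measure.\<close>

primrec complexity :: "'v trm \<Rightarrow> nat" where
  "complexity (Var x) = 0"
| "complexity (CoVar x) = 0"
| "complexity Zero = 1"
| "complexity (Plus A B) = Suc (complexity A + complexity B)"
| "complexity (Scale r A) = Suc (complexity A)"
| "complexity (Join A B) = Suc (complexity A + complexity B)"
| "complexity (Meet A B) = Suc (complexity A + complexity B)"

text \<open>Base 3 makes the measure decrease when the rule for \<open>\<squnion>\<close> replaces one sequent by two.\<close>

definition measure_hs :: "'v hypersequent \<Rightarrow> nat" where
  "measure_hs H = (\<Sum>\<Gamma>\<in>#H. 3 ^ (\<Sum>(r, A)\<in>#\<Gamma>. complexity A))"

text \<open>Each logical rule read upwards preserves validity and lowers the measure, so non-atomic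
  terms are decomposed one occurrence at a time until only atoms remain.\<close>

lemma cf_derivable_complete:
  fixes H :: "'v hypersequent"
  shows "valid H \<Longrightarrow> cf_derivable H"
proof (induction "measure_hs H" arbitrary: H rule: less_induct)
  case less
  show ?case
  proof (cases "\<forall>\<Gamma>\<in>#H. snd ` set_mset \<Gamma> \<subseteq> atoms UNIV")
    case True
    then show ?thesis using cf_derivable_atomic less.prems by blast
  next
    case False
    then obtain \<Gamma>' r A where *: "\<Gamma>' \<in># H" "(r, A) \<in># \<Gamma>'" "A \<notin> atoms UNIV"
      by (auto simp: image_subset_iff)
    define \<Gamma> G where "\<Gamma> = \<Gamma>' - {#(r, A)#}" and "G = H - {#\<Gamma>'#}"
    have H: "H = add_mset (\<Gamma> + wvec [r] A) G" using * by (simp add: \<Gamma>_def G_def)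
    have IH: "cf_derivable K" if "measure_hs K < measure_hs H" "valid K" for K :: "'v hypersequent"
      using less that by blast
    note rule = cf_derivable_rule
    note val = less.prems[unfolded H valid_add_mset, simplified]
    \<comment> \<open>Used for \<squnion>: \<open>c\<close> is the exponent of the conclusion
      without the outer connective, and it bounds the exponents of both new sequents.\<close>
    have pow: "(3::nat) ^ a + 3 ^ b < 3 * 3 ^ c" if "a \<le> c" "b \<le> c" for a b c :: nat
    proof -
      have "(3::nat) ^ a \<le> 3 ^ c" "(3::nat) ^ b \<le> 3 ^ c" "(0::nat) < 3 ^ c"
        using that by (simp_all add: power_increasing)
      then show ?thesis by linarith
    qed
    show ?thesis
    proof (cases A)
      case (Var x)
      then show ?thesis using * by (simp add: atoms_def)
    next
      case (CoVar x)
      then show ?thesis using * by (simp add: atoms_def)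
    next
      case Zero
      have "cf_derivable (add_mset \<Gamma> G)"
        using val by (intro IH) (auto simp: H Zero measure_hs_def valid_add_mset)
      then show ?thesis using rule[OF hr_rule.zero[of \<Gamma> G "[r]"]] by (simp add: H Zero)
    next
      case (Plus B D)
      have "cf_derivable (add_mset (\<Gamma> + wvec [r] B + wvec [r] D) G)"
        using val
        by (intro IH) (auto simp: H Plus measure_hs_def valid_add_mset algebra_simps power_add)
      then show ?thesis using rule[OF hr_rule.plus[of \<Gamma> "[r]"]] by (simp add: H Plus)
    next
      case (Scale s B)
      have "cf_derivable (add_mset (\<Gamma> + wvec (map ((*) s) [r]) B) G)"
        using val
        by (intro IH) (auto simp: H Scale measure_hs_def valid_add_mset algebra_simps)
      then show ?thesis using rule[OF hr_rule.times[of \<Gamma> s "[r]"]] by (simp add: H Scale)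
    next
      case (Join B D)
      have "cf_derivable (add_mset (\<Gamma> + wvec [r] B) (add_mset (\<Gamma> + wvec [r] D) G))"
      proof (rule IH)
        show "valid (add_mset (\<Gamma> + wvec [r] B) (add_mset (\<Gamma> + wvec [r] D) G))"
          using less.prems by (simp add: H Join valid_add_mset max_weighted_nonneg add.commute)
      qed (simp add: H Join measure_hs_def pow)
      then show ?thesis using rule[OF hr_rule.join[of \<Gamma> "[r]"]] by (simp add: H Join)
    next
      case (Meet B D)
      \<comment> \<open>The outer \<open>Meet\<close> counts one, so a weak bound on
        \<open>E\<close> already gives a strict decrease.\<close>
      have less': "measure_hs (add_mset (\<Gamma> + wvec [r] E) G) < measure_hs H"
        if "complexity E \<le> complexity B + complexity D" for E
        using that by (simp add: H Meet measure_hs_def less_Suc_eq_le flip: power_Suc)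
      have "cf_derivable (add_mset (\<Gamma> + wvec [r] B) G)"
           "cf_derivable (add_mset (\<Gamma> + wvec [r] D) G)"
        using val
        by (auto intro!: IH less' simp del: wvec_simps
            simp: Meet valid_add_mset min_weighted_nonneg add.commute)
      then show ?thesis using rule[OF hr_rule.meet[of \<Gamma> "[r]"]] by (simp add: H Meet)
    qed
  qed
qed

theorem theorem3p13:
  fixes G :: "'v :: countable hypersequent"
  assumes "\<exists>d. derivation d \<and> concl d = G"
  shows "\<exists>d. derivation d \<and> can_free d \<and> concl d = G"
  using assms derivation_sound cf_derivable_complete unfolding cf_derivable_def by blast

end
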